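(* Let $N\ge1$, $X\in\mathbb{R}^{n\times d}$, $Y\in\mathbb{R}^{m\times d}$, let $\sigma_1,\dots,\sigma_N:\mathbb{R}\to\mathbb{R}$ be twice differentiable, and let $\mathbf{W}=[W_0,\dots,W_N]$ with $W_0\in\mathbb{R}^{r_0\times n}$, $W_j\in\mathbb{R}^{r_j\times r_{j-1}}$ for $1\le j\le N-1$, and $W_N\in\mathbb{R}^{m\times r_{N-1}}$. Consider $$F(\mathbf{W})=\tfrac12\big\|Y-W_N\sigma_N(W_{N-1}\sigma_{N-1}(\cdots\sigma_1(W_0X)\cdots))\big\|_F^2.$$ Write $H_0=X$ and $H_{j}=\sigma_{j}(W_{j-1}H_{j-1})$ for $1\le j\le N$. Then for each $0\le j\le N$, $$\nabla_{W_j}F(\mathbf{W})=A_j\,H_j^T,$$ where $$A_j=\sigma'_{j+1}(W_jH_j)\circ\Big(W_{j+1}^T\Big(\sigma'_{j+2}(W_{j+1}H_{j+1})\circ\cdots\circ\Big(W_{N-1}^T\Big(\sigma'_N(W_{N-1}H_{N-1})\circ\big(W_N^T(W_NH_N-Y)\big)\Big)\Big)\cdots\Big)\Big),$$ that is, $A_N=W_NH_N-Y$ and $A_j=\sigma'_{j+1}(W_jH_j)\circ(W_{j+1}^TA_{j+1})$ for $0\le j\le N-1$. Moreover, first order stationary points of $F$ are characterized by two main cases, i.e. $\mathbf{W}$ is a first order stationary point if and only if one of the following holds: (1) the misfit is exactly zero, $W_NH_N=Y$; if such points are possible, then these points correspond to local minima of $F$ (in the sense defined in the context: all eigenvalues of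 the Hessian of $F$ there are nonnegative); (2) for each block $j\in\{0,\dots,N\}$ the orthogonality condition $A_j\perp H_j^T$ holds.
   Context: Each $\sigma_j$ and its derivative $\sigma_j'$ are applied to matrices elementwise. $\circ$ is the Hadamard (elementwise) product and $\|\cdot\|_F$ the Frobenius norm. For $A\in\mathbb{R}^{p\times q}$ and $B\in\mathbb{R}^{q\times k}$, $A\perp B$ means that the rows of $A$ are orthogonal to the columns of $B$, i.e. $AB=0$. $\nabla_{W_j}F$ denotes the matrix of partial derivatives of $F$ with respect to the entries of $W_j$ (same shape as $W_j$). A first order stationary point is a point where the gradient of $F$, i.e. every block $\nabla_{W_j}F$, vanishes. A point is called a local minimum of $F$ if the eigenvalues of the Hessian $\nabla^2F$ (with respect to the vector of all entries of $\mathbf{W}$) at that point are all nonnegative. *)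

theory Defs
  imports "HOL-Analysis.Derivative" "Jordan_Normal_Form.Char_Poly"
begin

definition frobenius_norm :: "real mat \<Rightarrow> real" where
  "frobenius_norm A = sqrt (\<Sum>i<dim_row A. \<Sum>k<dim_col A. (A $$ (i, k))\<^sup>2)"

definition hadamard :: "real mat \<Rightarrow> real mat \<Rightarrow> real mat" (infixl "\<circ>\<^sub>H" 70) where
  "A \<circ>\<^sub>H B = mat (dim_row A) (dim_col A) (\<lambda>ik. A $$ ik * B $$ ik)"

definition mat_perp :: "real mat \<Rightarrow> real mat \<Rightarrow> bool" (infix "\<bottom>\<^sub>M" 50) where
  "A \<bottom>\<^sub>M B \<longleftrightarrow> (\<forall>i<dim_row A. \<forall>k<dim_col B. scalar_prod (row A i) (col B k) = 0)"

text \<open>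
  The weights \<open>[W\<^sub>0, \<dots>, W\<^sub>N]\<close> are a function \<open>W :: nat \<Rightarrow> real mat\<close> of which only the values at
  \<open>0, \<dots>, N\<close> matter; likewise only \<open>\<sigma> 1, \<dots>, \<sigma> N\<close> are used of \<open>\<sigma> :: nat \<Rightarrow> real \<Rightarrow> real\<close>.
\<close>

fun layer :: "(nat \<Rightarrow> real \<Rightarrow> real) \<Rightarrow> real mat \<Rightarrow> (nat \<Rightarrow> real mat) \<Rightarrow> nat \<Rightarrow> real mat" where
  "layer \<sigma> X W 0 = X"
| "layer \<sigma> X W (Suc j) = map_mat (\<sigma> (Suc j)) (W j * layer \<sigma> X W j)"

definition loss ::
  "(nat \<Rightarrow> real \<Rightarrow> real) \<Rightarrow> nat \<Rightarrow> real mat \<Rightarrow> real mat \<Rightarrow> (nat \<Rightarrow> real mat) \<Rightarrow> real" where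
  "loss \<sigma> N X Y W = 1 / 2 * (frobenius_norm (Y - W N * layer \<sigma> X W N))\<^sup>2"

text \<open>
  The backward recursion for \<open>A\<^sub>j\<close>. It is meant for \<open>j \<le> N\<close>; for \<open>j > N\<close> it returns \<open>A\<^sub>N\<close>.
\<close>

function backprop ::
  "(nat \<Rightarrow> real \<Rightarrow> real) \<Rightarrow> nat \<Rightarrow> real mat \<Rightarrow> real mat \<Rightarrow> (nat \<Rightarrow> real mat) \<Rightarrow> nat \<Rightarrow> real mat" where
  "backprop \<sigma> N X Y W j =
    (if j < N
     then map_mat (deriv (\<sigma> (Suc j))) (W j * layer \<sigma> X W j)
            \<circ>\<^sub>H (transpose_mat (W (Suc j)) * backprop \<sigma> N X Y W (Suc j))
     else W N * layer \<sigma> X W N - Y)"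
  by auto
termination
  by (relation "measure (\<lambda>(\<sigma>, N, X, Y, W, j). N - j)") auto

declare backprop.simps [simp del]

text \<open>
  Differential calculus for a real function \<open>F\<close> of a block tuple \<open>W\<close>. A coordinate is a triple
  \<open>(j, a, b)\<close>, standing for the entry of \<open>W\<^sub>j\<close> in row \<open>a\<close> and column \<open>b\<close> (counted from 0).
\<close>

type_synonym coord = "nat \<times> nat \<times> nat"

text \<open>
  The order of this list is the order in which the entries of \<open>W\<^sub>0, \<dots>, W\<^sub>N\<close> are stacked into one
  vector.
\<close>

definition coords :: "nat \<Rightarrow> (nat \<Rightarrow> real mat) \<Rightarrow> coord list" where
  "coords N W =
    [(j, a, b). j \<leftarrow> [0..<Suc N], a \<leftarrow> [0..<dim_row (W j)], b \<leftarrow> [0..<dim_col (W j)]]"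

definition entry :: "(nat \<Rightarrow> real mat) \<Rightarrow> coord \<Rightarrow> real" where
  "entry W = (\<lambda>(j, a, b). W j $$ (a, b))"

definition set_entry :: "(nat \<Rightarrow> real mat) \<Rightarrow> coord \<Rightarrow> real \<Rightarrow> nat \<Rightarrow> real mat" where
  "set_entry W = (\<lambda>(j, a, b) t. W(j :=
     mat (dim_row (W j)) (dim_col (W j)) (\<lambda>ik. if ik = (a, b) then t else W j $$ ik)))"

definition partially_differentiable ::
  "((nat \<Rightarrow> real mat) \<Rightarrow> real) \<Rightarrow> coord \<Rightarrow> (nat \<Rightarrow> real mat) \<Rightarrow> bool" where
  "partially_differentiable F p W \<longleftrightarrow> (\<lambda>t. F (set_entry W p t)) differentiable (at (entry W p))"

definition partial_deriv ::
  "((nat \<Rightarrow> real mat) \<Rightarrow> real) \<Rightarrow> coord \<Rightarrow> (nat \<Rightarrow> real mat) \<Rightarrow> real" where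
  "partial_deriv F p W = deriv (\<lambda>t. F (set_entry W p t)) (entry W p)"

definition grad_block ::
  "((nat \<Rightarrow> real mat) \<Rightarrow> real) \<Rightarrow> nat \<Rightarrow> (nat \<Rightarrow> real mat) \<Rightarrow> real mat" where
  "grad_block F j W =
    mat (dim_row (W j)) (dim_col (W j)) (\<lambda>(a, b). partial_deriv F (j, a, b) W)"

definition stationary_point ::
  "((nat \<Rightarrow> real mat) \<Rightarrow> real) \<Rightarrow> nat \<Rightarrow> (nat \<Rightarrow> real mat) \<Rightarrow> bool" where
  "stationary_point F N W \<longleftrightarrow>
    (\<forall>p\<in>set (coords N W). partially_differentiable F p W) \<and>
    (\<forall>j\<le>N. grad_block F j W = 0\<^sub>m (dim_row (W j)) (dim_col (W j)))"

text \<open>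
  Existence of all second partial derivatives at \<open>W\<close>. The first partial derivatives have to exist
  near \<open>W\<close> on the line along which they are differentiated, since \<^const>\<open>partial_deriv\<close> is arbitrary
  where they do not.
\<close>

definition twice_partially_differentiable ::
  "((nat \<Rightarrow> real mat) \<Rightarrow> real) \<Rightarrow> nat \<Rightarrow> (nat \<Rightarrow> real mat) \<Rightarrow> bool" where
  "twice_partially_differentiable F N W \<longleftrightarrow>
    (\<forall>p\<in>set (coords N W). \<forall>q\<in>set (coords N W).
       (\<forall>\<^sub>F t in nhds (entry W q). partially_differentiable F p (set_entry W q t)) \<and>
       partially_differentiable (partial_deriv F p) q W)"

definition hessian ::
  "((nat \<Rightarrow> real mat) \<Rightarrow> real) \<Rightarrow> nat \<Rightarrow> (nat \<Rightarrow> real mat) \<Rightarrow> real mat" where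
  "hessian F N W = mat (length (coords N W)) (length (coords N W))
    (\<lambda>(k, l). partial_deriv (partial_deriv F (coords N W ! l)) (coords N W ! k) W)"

text \<open>
  A local minimum in the second-order sense: the Hessian exists and its eigenvalues are
  nonnegative. Eigenvalues are taken over the complex numbers, so that realness of the whole
  spectrum is part of the assertion and does not depend on symmetry of the Hessian.
\<close>

definition second_order_local_min ::
  "((nat \<Rightarrow> real mat) \<Rightarrow> real) \<Rightarrow> nat \<Rightarrow> (nat \<Rightarrow> real mat) \<Rightarrow> bool" where
  "second_order_local_min F N W \<longleftrightarrow>
    twice_partially_differentiable F N W \<and>
    (\<forall>z. eigenvalue (map_mat complex_of_real (hessian F N W)) z \<longrightarrow> z \<in> \<real> \<and> 0 \<le> Re z)"

end

theory Submission
  imports Defs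
begin

text \<open>
  Along a curve of weights, the layers satisfy a forward recursion for their derivatives, and the
  backward recursion for \<open>A\<^sub>j\<close> is its adjoint with respect to the Frobenius inner product. Hence
  the derivative \<open>\<langle>W\<^sub>N H\<^sub>N - Y, S\<^sub>N\<rangle>\<close> of the loss, \<open>S\<^sub>N\<close> being the derivative of \<open>W\<^sub>N H\<^sub>N\<close>, equals
  \<open>\<langle>A\<^sub>j, S\<^sub>j\<rangle>\<close> as long as only blocks up to \<open>j\<close> vary, which gives the gradient. Where the misfit
  vanishes, differentiating \<open>\<langle>W\<^sub>N H\<^sub>N - Y, S\<^sub>N\<rangle>\<close> once more leaves only \<open>\<langle>S\<^sub>N, S\<^sub>N\<rangle>\<close>: the Hessian is
  the Gram matrix of the vectors \<open>S\<^sub>N\<close> over all coordinate directions.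
\<close>

section \<open>The Frobenius inner product and orthogonality of matrices\<close>

definition frob_inner :: "real mat \<Rightarrow> real mat \<Rightarrow> real" where
  "frob_inner A B = (\<Sum>i<dim_row A. \<Sum>k<dim_col A. A $$ (i, k) * B $$ (i, k))"

text \<open>Both sides are the same triple sum over G_ik M_ih T_hk; only the order of summation
  differs.\<close>

lemma frob_inner_adjoint:
  assumes "G \<in> carrier_mat p q" "M \<in> carrier_mat p l" "T \<in> carrier_mat l q"
  shows "frob_inner G (M * T) = frob_inner (transpose_mat M * G) T"
proof -
  have "frob_inner G (M * T) = (\<Sum>i<p. \<Sum>k<q. \<Sum>h<l. G $$ (i, k) * (M $$ (i, h) * T $$ (h, k)))"
    using assms by (auto simp: frob_inner_def scalar_prod_def sum_distrib_left atLeast0LessThan intro!: sum.cong)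
  also have "\<dots> = (\<Sum>h<l. \<Sum>k<q. \<Sum>i<p. G $$ (i, k) * (M $$ (i, h) * T $$ (h, k)))"
    by (subst sum.swap, subst (2) sum.swap) (rule sum.swap)
  also have "\<dots> = frob_inner (transpose_mat M * G) T"
    using assms by (auto simp: frob_inner_def scalar_prod_def sum_distrib_right sum_distrib_left
        atLeast0LessThan mult_ac intro!: sum.cong)
  finally show ?thesis .
qed

text \<open>Elementwise multiplication by \<open>D\<close> is a diagonal operator on matrix entries,
  hence self-adjoint.\<close>

lemma frob_inner_hadamard:
  assumes "G \<in> carrier_mat p q" "D \<in> carrier_mat p q" "S \<in> carrier_mat p q"
  shows "frob_inner G (D \<circ>\<^sub>H S) = frob_inner (D \<circ>\<^sub>H G) S"
  using assms by (auto simp: frob_inner_def hadamard_def mult_ac intro!: sum.cong)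

definition unit_mat :: "nat \<Rightarrow> nat \<Rightarrow> nat \<Rightarrow> nat \<Rightarrow> real mat" where
  "unit_mat p q a b = mat p q (\<lambda>ik. if ik = (a, b) then 1 else 0)"

text \<open>The product with the matrix unit has row \<open>b\<close> of \<open>H\<close> in row
  \<open>a\<close> and zeros elsewhere, so the inner product pairs row \<open>a\<close> of
  \<open>A\<close> with row \<open>b\<close> of \<open>H\<close>. This turns a derivative in one
  weight entry into an entry of A_j H_j^T.\<close>

lemma frob_inner_unit_mat_mult:
  assumes "A \<in> carrier_mat p q" "H \<in> carrier_mat l q" "a < p" "b < l"
  shows "frob_inner A (unit_mat p l a b * H) = (A * transpose_mat H) $$ (a, b)"
proof -
  have E: "(unit_mat p l a b * H) $$ (i, k) = (if i = a then H $$ (b, k) else 0)"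
    if "i < p" "k < q" for i k
  proof -
    have "(unit_mat p l a b * H) $$ (i, k)
        = (\<Sum>h<l. (if i = a \<and> h = b then H $$ (b, k) else 0))"
      using assms that
      by (auto simp: unit_mat_def scalar_prod_def atLeast0LessThan intro!: sum.cong)
    also have "\<dots> = (if i = a then H $$ (b, k) else 0)"
      using assms by (auto simp: sum.delta)
    finally show ?thesis .
  qed
  have "frob_inner A (unit_mat p l a b * H)
      = (\<Sum>i<p. \<Sum>k<q. A $$ (i, k) * (if i = a then H $$ (b, k) else 0))"
    using assms E by (auto simp: frob_inner_def intro!: sum.cong)
  also have "\<dots> = (\<Sum>i<p. if i = a then (\<Sum>k<q. A $$ (i, k) * H $$ (b, k)) else 0)"
    by (rule sum.cong) auto
  also have "\<dots> = (A * transpose_mat H) $$ (a, b)"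
    using assms by (auto simp: scalar_prod_def atLeast0LessThan intro!: sum.cong)
  finally show ?thesis .
qed

lemma hadamard_carrier [intro, simp]:
  "A \<in> carrier_mat p q \<Longrightarrow> A \<circ>\<^sub>H B \<in> carrier_mat p q"
  by (auto simp: hadamard_def)

lemma mat_perp_iff:
  assumes "A \<in> carrier_mat p q" "B \<in> carrier_mat q l"
  shows "A \<bottom>\<^sub>M B \<longleftrightarrow> A * B = 0\<^sub>m p l"
proof
  show "A * B = 0\<^sub>m p l" if "A \<bottom>\<^sub>M B"
    using that assms by (intro eq_matI) (auto simp: mat_perp_def)
  show "A \<bottom>\<^sub>M B" if "A * B = 0\<^sub>m p l"
    unfolding mat_perp_def
  proof (intro allI impI)
    fix i k assume ik: "i < dim_row A" "k < dim_col B"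
    then have "(A * B) $$ (i, k) = row A i \<bullet> col B k" by simp
    then show "row A i \<bullet> col B k = 0" using that ik assms by auto
  qed
qed

section \<open>Entrywise derivatives of matrix-valued curves\<close>

text \<open>The shape is fixed at every parameter, not only at \<open>t\<close>, so that entries of
  sums and products can be unfolded along the whole curve.\<close>

definition has_mat_derivative ::
  "nat \<Rightarrow> nat \<Rightarrow> (real \<Rightarrow> real mat) \<Rightarrow> real mat \<Rightarrow> real \<Rightarrow> bool" where
  "has_mat_derivative p q M M' t \<longleftrightarrow>
    (\<forall>s. M s \<in> carrier_mat p q) \<and> M' \<in> carrier_mat p q \<and>
    (\<forall>i<p. \<forall>k<q. ((\<lambda>s. M s $$ (i, k)) has_real_derivative M' $$ (i, k)) (at t))"

lemma has_mat_derivativeI: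
  assumes "\<And>s. M s \<in> carrier_mat p q" "M' \<in> carrier_mat p q"
    and "\<And>i k. i < p \<Longrightarrow> k < q \<Longrightarrow> ((\<lambda>s. M s $$ (i, k)) has_real_derivative M' $$ (i, k)) (at t)"
  shows "has_mat_derivative p q M M' t"
  using assms by (auto simp: has_mat_derivative_def)

lemma has_mat_derivativeD:
  assumes "has_mat_derivative p q M M' t"
  shows "M s \<in> carrier_mat p q" "M' \<in> carrier_mat p q"
    and "i < p \<Longrightarrow> k < q \<Longrightarrow> ((\<lambda>s. M s $$ (i, k)) has_real_derivative M' $$ (i, k)) (at t)"
  using assms by (auto simp: has_mat_derivative_def)

lemma has_mat_derivative_const:
  assumes "C \<in> carrier_mat p q"
  shows "has_mat_derivative p q (\<lambda>_. C) (0\<^sub>m p q) t"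
  using assms by (intro has_mat_derivativeI) auto

lemma has_mat_derivative_add:
  assumes "has_mat_derivative p q M M' t" "has_mat_derivative p q L L' t"
  shows "has_mat_derivative p q (\<lambda>s. M s + L s) (M' + L') t"
proof (rule has_mat_derivativeI)
  note D = has_mat_derivativeD[OF assms(1)] has_mat_derivativeD[OF assms(2)]
  show "M s + L s \<in> carrier_mat p q" for s using D by auto
  show "M' + L' \<in> carrier_mat p q" using D by auto
  fix i k assume ik: "i < p" "k < q"
  have "(M s + L s) $$ (i, k) = M s $$ (i, k) + L s $$ (i, k)" for s
    using D(1)[of s] D(4)[of s] ik by auto
  moreover have "(M' + L') $$ (i, k) = M' $$ (i, k) + L' $$ (i, k)"
    using D(2,5) ik by auto
  ultimately show "((\<lambda>s. (M s + L s) $$ (i, k)) has_real_derivative (M' + L') $$ (i, k)) (at t)"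
    using D(3)[OF ik] D(6)[OF ik] by (auto intro: DERIV_add)
qed

lemma has_mat_derivative_mult:
  assumes "has_mat_derivative p l M M' t" "has_mat_derivative l q L L' t"
  shows "has_mat_derivative p q (\<lambda>s. M s * L s) (M' * L t + M t * L') t"
proof (rule has_mat_derivativeI)
  note D = has_mat_derivativeD[OF assms(1)] has_mat_derivativeD[OF assms(2)]
  show "M s * L s \<in> carrier_mat p q" for s by (rule mult_carrier_mat[OF D(1) D(4)])
  show "M' * L t + M t * L' \<in> carrier_mat p q"
    by (intro add_carrier_mat mult_carrier_mat[OF D(1) D(5)])
  fix i k assume ik: "i < p" "k < q"
  have 1: "(M s * L s) $$ (i, k) = (\<Sum>h<l. M s $$ (i, h) * L s $$ (h, k))" for s
    using D(1)[of s] D(4)[of s] ik by (auto simp: scalar_prod_def atLeast0LessThan)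
  \<comment> \<open>The second summand is commuted into the form in which \<open>DERIV_mult\<close>
    delivers it.\<close>
  have 2: "(M' * L t + M t * L') $$ (i, k)
      = (\<Sum>h<l. M' $$ (i, h) * L t $$ (h, k) + L' $$ (h, k) * M t $$ (i, h))"
    using D(1)[of t] D(4)[of t] D(2,5) ik
    by (auto simp: scalar_prod_def atLeast0LessThan sum.distrib mult.commute)
  show "((\<lambda>s. (M s * L s) $$ (i, k)) has_real_derivative (M' * L t + M t * L') $$ (i, k)) (at t)"
    unfolding 1 2 using D(3,6) ik by (intro DERIV_sum DERIV_mult) auto
qed

lemma has_mat_derivative_hadamard:
  assumes "has_mat_derivative p q M M' t" "has_mat_derivative p q L L' t"
  shows "has_mat_derivative p q (\<lambda>s. M s \<circ>\<^sub>H L s) (M' \<circ>\<^sub>H L t + L' \<circ>\<^sub>H M t) t"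
proof (rule has_mat_derivativeI)
  note D = has_mat_derivativeD[OF assms(1)] has_mat_derivativeD[OF assms(2)]
  show "M s \<circ>\<^sub>H L s \<in> carrier_mat p q" for s using D by auto
  show "M' \<circ>\<^sub>H L t + L' \<circ>\<^sub>H M t \<in> carrier_mat p q" using D by auto
  fix i k assume ik: "i < p" "k < q"
  have 1: "(M s \<circ>\<^sub>H L s) $$ (i, k) = M s $$ (i, k) * L s $$ (i, k)" for s
    using D(1)[of s] ik by (auto simp: hadamard_def)
  have 2: "(M' \<circ>\<^sub>H L t + L' \<circ>\<^sub>H M t) $$ (i, k)
      = M' $$ (i, k) * L t $$ (i, k) + L' $$ (i, k) * M t $$ (i, k)"
    using D(2,5) ik by (auto simp: hadamard_def)
  show "((\<lambda>s. (M s \<circ>\<^sub>H L s) $$ (i, k)) has_real_derivative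
      (M' \<circ>\<^sub>H L t + L' \<circ>\<^sub>H M t) $$ (i, k)) (at t)"
    unfolding 1 2 using D(3,6) ik by (intro DERIV_mult) auto
qed

text \<open>The chain rule in each entry; it is the source of the Hadamard factors. It serves with
  \<open>f\<close> an activation for first derivatives and with \<open>f\<close> the derivative of
  an activation for second ones.\<close>

lemma has_mat_derivative_map:
  assumes "has_mat_derivative p q M M' t" "\<And>x. f differentiable (at x)"
  shows "has_mat_derivative p q (\<lambda>s. map_mat f (M s)) (map_mat (deriv f) (M t) \<circ>\<^sub>H M') t"
proof (rule has_mat_derivativeI)
  note D = has_mat_derivativeD[OF assms(1)]
  show "map_mat f (M s) \<in> carrier_mat p q" for s using D by auto
  show "map_mat (deriv f) (M t) \<circ>\<^sub>H M' \<in> carrier_mat p q" using D by auto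
  fix i k assume ik: "i < p" "k < q"
  have 1: "map_mat f (M s) $$ (i, k) = f (M s $$ (i, k))" for s
    using D(1)[of s] ik by auto
  have 2: "(map_mat (deriv f) (M t) \<circ>\<^sub>H M') $$ (i, k) = deriv f (M t $$ (i, k)) * M' $$ (i, k)"
    using D(1)[of t] ik by (auto simp: hadamard_def)
  have "DERIV f (M t $$ (i, k)) :> deriv f (M t $$ (i, k))"
    using assms(2) by (simp add: DERIV_deriv_iff_real_differentiable)
  then show "((\<lambda>s. map_mat f (M s) $$ (i, k)) has_real_derivative
      (map_mat (deriv f) (M t) \<circ>\<^sub>H M') $$ (i, k)) (at t)"
    unfolding 1 2 by (rule DERIV_chain2[OF _ D(3)[OF ik]])
qed

lemma has_real_derivative_frob_inner:
  assumes "has_mat_derivative p q M M' t" "has_mat_derivative p q L L' t"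
  shows "((\<lambda>s. frob_inner (M s) (L s)) has_real_derivative
      frob_inner M' (L t) + frob_inner (M t) L') (at t)"
proof -
  note D = has_mat_derivativeD[OF assms(1)] has_mat_derivativeD[OF assms(2)]
  have 1: "frob_inner (M s) (L s) = (\<Sum>i<p. \<Sum>k<q. M s $$ (i, k) * L s $$ (i, k))" for s
    using D(1)[of s] by (simp add: frob_inner_def)
  have 2: "frob_inner M' (L t) + frob_inner (M t) L'
      = (\<Sum>i<p. \<Sum>k<q. M' $$ (i, k) * L t $$ (i, k) + L' $$ (i, k) * M t $$ (i, k))"
    using D(1)[of t] D(2) by (auto simp: frob_inner_def sum.distrib mult.commute)
  show ?thesis
    unfolding 1 2 using D(3,6) by (intro DERIV_sum DERIV_mult) auto
qed

section \<open>Gram matrices\<close>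

text \<open>Pairing M v = z v with the conjugate of v gives z |v|^2 on one side and a sum of squared
  moduli on the other. Since v is complex, this shows at once that z is real and that it is
  nonnegative.\<close>

lemma gram_eigenvalue_nonneg:
  fixes f :: "nat \<Rightarrow> 'c \<Rightarrow> real"
  assumes "eigenvalue (map_mat complex_of_real (mat K K (\<lambda>(k, l). \<Sum>c\<in>C. f l c * f k c))) z"
  shows "z \<in> \<real> \<and> 0 \<le> Re z"
proof -
  define M where "M = map_mat complex_of_real (mat K K (\<lambda>(k, l). \<Sum>c\<in>C. f l c * f k c))"
  from assms obtain v where v: "v \<in> carrier_vec K" "v \<noteq> 0\<^sub>v K" "M *\<^sub>v v = z \<cdot>\<^sub>v v"
    unfolding eigenvalue_def eigenvector_def M_def by auto
  \<comment> \<open>\<open>P\<close> is the squared norm of \<open>v\<close>, and \<open>Q\<close>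
    will be the value of the quadratic form of \<open>M\<close> at \<open>v\<close>.\<close>
  define P where "P = (\<Sum>k<K. (cmod (v $ k))\<^sup>2)"
  define Q where "Q = (\<Sum>c\<in>C. (cmod (\<Sum>k<K. of_real (f k c) * v $ k))\<^sup>2)"
  have row: "(\<Sum>l<K. \<Sum>c\<in>C. of_real (f l c) * of_real (f k c) * v $ l) = z * v $ k"
    if "k < K" for k
  proof -
    have "(M *\<^sub>v v) $ k = (\<Sum>l<K. \<Sum>c\<in>C. of_real (f l c) * of_real (f k c) * v $ l)"
      using v(1) that by (auto simp: M_def scalar_prod_def atLeast0LessThan sum_distrib_right
          intro!: sum.cong)
    then show ?thesis using v that by simp
  qed
  have "z * of_real P = (\<Sum>k<K. cnj (v $ k) * (z * v $ k))"
    unfolding P_def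
    by (auto simp: sum_distrib_left complex_norm_square mult_ac simp del: of_real_power intro!: sum.cong)
  also have "\<dots> = (\<Sum>k<K. \<Sum>l<K. \<Sum>c\<in>C. cnj (v $ k) * (of_real (f l c) * of_real (f k c) * v $ l))"
    by (intro sum.cong) (simp_all add: row[symmetric] sum_distrib_left)
  \<comment> \<open>With \<open>c\<close> outermost, each inner double sum factors into a number
    times its conjugate.\<close>
  also have "\<dots> = (\<Sum>c\<in>C. \<Sum>k<K. \<Sum>l<K. cnj (v $ k) * (of_real (f l c) * of_real (f k c) * v $ l))"
    by (subst (2) sum.swap, subst sum.swap) (rule refl)
  also have "\<dots> = of_real Q"
    unfolding Q_def
    by (auto simp: complex_norm_square sum_distrib_left sum_distrib_right mult_ac
        simp del: of_real_power intro!: sum.cong)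
  finally have eq: "z * of_real P = of_real Q" .
  obtain k where "k < K" "v $ k \<noteq> 0"
    using v(1,2) by (metis carrier_vecD eq_vecI index_zero_vec(1) index_zero_vec(2))
  then have "P > 0"
    unfolding P_def by (intro sum_pos2[of _ k]) auto
  moreover have "Q \<ge> 0"
    unfolding Q_def by (intro sum_nonneg) auto
  ultimately have "z = of_real (Q / P)" "Q / P \<ge> 0"
    using eq by (auto simp: field_simps)
  then show ?thesis by simp
qed

section \<open>Forward derivatives of the network\<close>

lemma set_coords:
  "(j, a, b) \<in> set (coords N W) \<longleftrightarrow> j \<le> N \<and> a < dim_row (W j) \<and> b < dim_col (W j)"
proof -
  have "j \<in> set [0..<Suc N] \<longleftrightarrow> j \<le> N" by auto
  then show ?thesis
    unfolding coords_def by (force simp del: upt_Suc)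
qed

text \<open>The directional derivative of \<open>layer\<close> at \<open>W\<close> in direction
  \<open>V\<close>, from differentiating its recursion. It starts at zero because \<open>X\<close>
  does not depend on the weights.\<close>

fun layer_tangent ::
  "(nat \<Rightarrow> real \<Rightarrow> real) \<Rightarrow> real mat \<Rightarrow> (nat \<Rightarrow> real mat) \<Rightarrow> (nat \<Rightarrow> real mat) \<Rightarrow> nat \<Rightarrow> real mat" where
  "layer_tangent \<sigma> X W V 0 = 0\<^sub>m (dim_row X) (dim_col X)"
| "layer_tangent \<sigma> X W V (Suc j) = map_mat (deriv (\<sigma> (Suc j))) (W j * layer \<sigma> X W j)
      \<circ>\<^sub>H (V j * layer \<sigma> X W j + W j * layer_tangent \<sigma> X W V j)"

text \<open>The S_j of the introduction: the derivative of W_j H_j, before any activation is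
  applied.\<close>

definition preact_tangent ::
  "(nat \<Rightarrow> real \<Rightarrow> real) \<Rightarrow> real mat \<Rightarrow> (nat \<Rightarrow> real mat) \<Rightarrow> (nat \<Rightarrow> real mat) \<Rightarrow> nat \<Rightarrow> real mat" where
  "preact_tangent \<sigma> X W V j = V j * layer \<sigma> X W j + W j * layer_tangent \<sigma> X W V j"

text \<open>
  Block \<open>j\<close> has shape \<open>s (Suc j) \<times> s j\<close>, so \<open>s\<close> lists the widths \<open>n, r\<^sub>0, \<dots>, r\<^sub>N\<^sub>-\<^sub>1, m\<close>.
\<close>

locale network =
  fixes N d :: nat and s :: "nat \<Rightarrow> nat" and X Y :: "real mat" and \<sigma> :: "nat \<Rightarrow> real \<Rightarrow> real"
  assumes X: "X \<in> carrier_mat (s 0) d"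
    and Y: "Y \<in> carrier_mat (s (Suc N)) d"
    and \<sigma>: "\<And>j x. j < N \<Longrightarrow> \<sigma> (Suc j) differentiable (at x)"
    and \<sigma>': "\<And>j x. j < N \<Longrightarrow> deriv (\<sigma> (Suc j)) differentiable (at x)"
begin

section \<open>Shapes, and vanishing of the backward matrices at zero misfit\<close>

definition weights :: "(nat \<Rightarrow> real mat) \<Rightarrow> bool" where
  "weights W \<longleftrightarrow> (\<forall>j\<le>N. W j \<in> carrier_mat (s (Suc j)) (s j))"

lemma weightsD: "weights W \<Longrightarrow> j \<le> N \<Longrightarrow> W j \<in> carrier_mat (s (Suc j)) (s j)"
  by (simp add: weights_def)

lemma layer_carrier: "weights W \<Longrightarrow> j \<le> N \<Longrightarrow> layer \<sigma> X W j \<in> carrier_mat (s j) d"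
proof (induction j)
  case (Suc j)
  then show ?case using weightsD[of W j] by auto
qed (use X in simp)

lemma layer_tangent_carrier:
  "weights W \<Longrightarrow> weights V \<Longrightarrow> j \<le> N \<Longrightarrow> layer_tangent \<sigma> X W V j \<in> carrier_mat (s j) d"
proof (induction j)
  case (Suc j)
  then show ?case using weightsD[of W j] layer_carrier[of W j] by auto
qed (use X in simp)

lemma preact_tangent_carrier:
  "weights W \<Longrightarrow> weights V \<Longrightarrow> j \<le> N \<Longrightarrow> preact_tangent \<sigma> X W V j \<in> carrier_mat (s (Suc j)) d"
  using weightsD[of W j] layer_tangent_carrier[of W V j] by (auto simp: preact_tangent_def)

lemma backprop_carrier:
  "weights W \<Longrightarrow> j \<le> N \<Longrightarrow> backprop \<sigma> N X Y W j \<in> carrier_mat (s (Suc j)) d"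
  using weightsD[of W j] layer_carrier[of W j] Y weightsD[of W N]
  by (cases "j < N") (subst backprop.simps; auto)+

text \<open>Downward induction from \<open>N\<close>: A_N is the misfit, and each earlier A_j is a
  linear image of A_{j+1}.\<close>

lemma backprop_eq_0:
  assumes "weights W" "W N * layer \<sigma> X W N = Y" "j \<le> N"
  shows "backprop \<sigma> N X Y W j = 0\<^sub>m (s (Suc j)) d"
  using assms(3)
proof (induction rule: inc_induct)
  case base
  show ?case using assms Y by (subst backprop.simps) simp
next
  case (step j)
  have "W j \<in> carrier_mat (s (Suc j)) (s j)" "W (Suc j) \<in> carrier_mat (s (Suc (Suc j))) (s (Suc j))"
    "layer \<sigma> X W j \<in> carrier_mat (s j) d"
    using assms(1) step.hyps by (auto intro: weightsD layer_carrier)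
  then show ?case using step
    by (subst backprop.simps) (auto simp: hadamard_def)
qed

text \<open>The recursion of \<open>layer_tangent\<close> is what the product and chain rules make
  of the recursion of \<open>layer\<close>.\<close>

lemma layer_has_mat_derivative:
  assumes "\<And>i. i \<le> N \<Longrightarrow> has_mat_derivative (s (Suc i)) (s i) (\<lambda>u. C u i) (V i) t" "j \<le> N"
  shows "has_mat_derivative (s j) d (\<lambda>u. layer \<sigma> X (C u) j) (layer_tangent \<sigma> X (C t) V j) t"
  using assms(2)
proof (induction j)
  case 0
  show ?case using has_mat_derivative_const[OF X] X by simp
next
  case (Suc j)
  then have "j < N" by simp
  with Suc show ?case
    by (auto intro!: has_mat_derivative_map has_mat_derivative_mult assms(1) \<sigma>)
qed

lemma preact_has_mat_derivative:
  assumes "\<And>i. i \<le> N \<Longrightarrow> has_mat_derivative (s (Suc i)) (s i) (\<lambda>u. C u i) (V i) t" "j \<le> N"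
  shows "has_mat_derivative (s (Suc j)) d (\<lambda>u. C u j * layer \<sigma> X (C u) j)
    (preact_tangent \<sigma> X (C t) V j) t"
  unfolding preact_tangent_def
  by (rule has_mat_derivative_mult[OF assms(1)[OF assms(2)]
        layer_has_mat_derivative[of C V t j, OF assms]])

text \<open>The base point moves along \<open>C\<close> while the direction \<open>U\<close> stays
  fixed. Existence suffices: in the Hessian this second derivative is paired with the misfit, which
  is zero where the Hessian is evaluated. Here the second differentiability of the activations
  enters.\<close>

lemma layer_tangent_has_mat_derivative:
  assumes "\<And>i. i \<le> N \<Longrightarrow> has_mat_derivative (s (Suc i)) (s i) (\<lambda>u. C u i) (V i) t"
    and "weights U" "j \<le> N"
  shows "\<exists>T. has_mat_derivative (s j) d (\<lambda>u. layer_tangent \<sigma> X (C u) U j) T t"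
  using assms(3)
proof (induction j)
  case 0
  show ?case using has_mat_derivative_const[of "0\<^sub>m (s 0) d" "s 0" d] X by auto
next
  case (Suc j)
  then obtain T where T: "has_mat_derivative (s j) d (\<lambda>u. layer_tangent \<sigma> X (C u) U j) T t"
    by auto
  from Suc.prems have j: "j < N" "j \<le> N" by auto
  note C = assms(1)[OF j(2)]
  note L = layer_has_mat_derivative[of C V t j, OF assms(1) j(2)]
  note U = has_mat_derivative_const[OF weightsD[OF assms(2) j(2)]]
  \<comment> \<open>The witness stays schematic and is assembled by the derivative rules.\<close>
  show ?case
    unfolding layer_tangent.simps
    by (rule exI, rule has_mat_derivative_hadamard[OF
          has_mat_derivative_map[OF has_mat_derivative_mult[OF C L] \<sigma>'[OF j(1)]]
          has_mat_derivative_add[OF has_mat_derivative_mult[OF U L] has_mat_derivative_mult[OF C T]]])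
qed

lemma preact_tangent_has_mat_derivative:
  assumes "\<And>i. i \<le> N \<Longrightarrow> has_mat_derivative (s (Suc i)) (s i) (\<lambda>u. C u i) (V i) t"
    and "weights U" "j \<le> N"
  shows "\<exists>T. has_mat_derivative (s (Suc j)) d (\<lambda>u. preact_tangent \<sigma> X (C u) U j) T t"
proof -
  obtain T where T: "has_mat_derivative (s j) d (\<lambda>u. layer_tangent \<sigma> X (C u) U j) T t"
    using layer_tangent_has_mat_derivative[of C V t U j] assms by blast
  note C = assms(1)[OF assms(3)]
  note L = layer_has_mat_derivative[of C V t j, OF assms(1,3)]
  note U = has_mat_derivative_const[OF weightsD[OF assms(2,3)]]
  show ?thesis
    unfolding preact_tangent_def
    by (rule exI, rule has_mat_derivative_add[OF has_mat_derivative_mult[OF U L]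
          has_mat_derivative_mult[OF C T]])
qed

text \<open>Squaring hides the sign, so the residual can be taken in the form of A_N; as an inner
  product it is open to the product rule.\<close>

lemma loss_eq:
  assumes "weights W"
  shows "loss \<sigma> N X Y W = 1 / 2 *
    frob_inner (W N * layer \<sigma> X W N - Y) (W N * layer \<sigma> X W N - Y)"
proof -
  define Z where "Z = W N * layer \<sigma> X W N"
  have Z: "Z \<in> carrier_mat (s (Suc N)) d"
    unfolding Z_def
    by (rule mult_carrier_mat[OF weightsD[OF assms order_refl] layer_carrier[OF assms order_refl]])
  have "(\<Sum>i<s (Suc N). \<Sum>k<d. ((Y - Z) $$ (i, k))\<^sup>2)
      = (\<Sum>i<s (Suc N). \<Sum>k<d. (Z - Y) $$ (i, k) * (Z - Y) $$ (i, k))"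
  proof (intro sum.cong refl)
    fix i k assume "i \<in> {..<s (Suc N)}" "k \<in> {..<d}"
    then have "(Y - Z) $$ (i, k) = - (Z - Y) $$ (i, k)"
      using Y Z by simp
    then show "((Y - Z) $$ (i, k))\<^sup>2 = (Z - Y) $$ (i, k) * (Z - Y) $$ (i, k)"
      by (simp add: power2_eq_square del: index_minus_mat)
  qed
  moreover have "frobenius_norm (Y - Z)
      = sqrt (\<Sum>i<s (Suc N). \<Sum>k<d. ((Y - Z) $$ (i, k))\<^sup>2)"
    unfolding frobenius_norm_def using Y Z by simp
  moreover have "frob_inner (Z - Y) (Z - Y)
      = (\<Sum>i<s (Suc N). \<Sum>k<d. (Z - Y) $$ (i, k) * (Z - Y) $$ (i, k))"
    unfolding frob_inner_def using Y Z by simp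
  \<comment> \<open>Nonnegativity lets the square cancel the square root in the norm.\<close>
  moreover have "0 \<le> (\<Sum>i<s (Suc N). \<Sum>k<d. ((Y - Z) $$ (i, k))\<^sup>2)"
    by (intro sum_nonneg) simp
  ultimately show ?thesis
    unfolding loss_def Z_def[symmetric] by simp
qed

section \<open>Gradient and Hessian of the loss\<close>

text \<open>The velocity of the line of weights along which \<open>partial_deriv\<close> in a
  coordinate is taken.\<close>

definition coord_direction :: "coord \<Rightarrow> nat \<Rightarrow> real mat" where
  "coord_direction = (\<lambda>(j, a, b) i.
     if i = j then unit_mat (s (Suc i)) (s i) a b else 0\<^sub>m (s (Suc i)) (s i))"

lemma weights_coord_direction: "weights (coord_direction p)"
  by (auto simp: weights_def coord_direction_def unit_mat_def split: prod.splits)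

lemma weights_set_entry: "weights W \<Longrightarrow> weights (set_entry W p t)"
  by (auto simp: weights_def set_entry_def split: prod.splits)

text \<open>The coordinate line passes through \<open>W\<close> at parameter
  \<open>entry W p\<close>, so derivatives taken there are expressed at \<open>W\<close>
  itself.\<close>

lemma set_entry_self: "set_entry W p (entry W p) = W"
  by (auto simp: set_entry_def entry_def split: prod.splits intro!: ext eq_matI)

lemma set_entry_has_mat_derivative:
  assumes "weights W" "i \<le> N"
  shows "has_mat_derivative (s (Suc i)) (s i) (\<lambda>u. set_entry W p u i) (coord_direction p i) t"
proof (rule has_mat_derivativeI)
  show "set_entry W p u i \<in> carrier_mat (s (Suc i)) (s i)" for u
    using weightsD[OF weights_set_entry[OF assms(1)] assms(2)] .
  show "coord_direction p i \<in> carrier_mat (s (Suc i)) (s i)"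
    using weightsD[OF weights_coord_direction assms(2)] .
  show "((\<lambda>u. set_entry W p u i $$ (k, l)) has_real_derivative coord_direction p i $$ (k, l)) (at t)"
    if "k < s (Suc i)" "l < s i" for k l
    using that weightsD[OF assms]
    by (cases p) (auto simp: set_entry_def coord_direction_def unit_mat_def)
qed

text \<open>The column of the Jacobian of the network output that belongs to coordinate
  \<open>p\<close>.\<close>

abbreviation coord_tangent :: "(nat \<Rightarrow> real mat) \<Rightarrow> coord \<Rightarrow> real mat" where
  "coord_tangent W p \<equiv> preact_tangent \<sigma> X W (coord_direction p) N"

lemma misfit_has_mat_derivative:
  assumes "weights W"
  shows "has_mat_derivative (s (Suc N)) d
    (\<lambda>u. set_entry W p u N * layer \<sigma> X (set_entry W p u) N - Y)
    (coord_tangent W p) (entry W p)"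
proof -
  let ?P = "\<lambda>u. set_entry W p u N * layer \<sigma> X (set_entry W p u) N"
  have P: "has_mat_derivative (s (Suc N)) d ?P (coord_tangent W p) (entry W p)"
    using preact_has_mat_derivative[of "\<lambda>u. set_entry W p u" "coord_direction p" "entry W p" N]
      set_entry_has_mat_derivative[OF assms] by (simp add: set_entry_self)
  \<comment> \<open>Subtracting \<open>Y\<close> becomes adding a constant curve, to which the sum
    rule applies.\<close>
  have "?P u + - Y = ?P u - Y" for u
    by (rule add_uminus_minus_mat[OF has_mat_derivativeD(1)[OF P] Y])
  then show ?thesis
    using has_mat_derivative_add[OF P has_mat_derivative_const[of "- Y"]]
      Y preact_tangent_carrier[OF assms weights_coord_direction, of N p] by simp
qed

lemma loss_has_real_derivative:
  assumes "weights W"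
  shows "((\<lambda>t. loss \<sigma> N X Y (set_entry W p t)) has_real_derivative
    frob_inner (W N * layer \<sigma> X W N - Y) (coord_tangent W p)) (at (entry W p))"
proof -
  \<comment> \<open>By symmetry the two terms of the product rule agree, which cancels the factor
    1/2.\<close>
  have comm: "frob_inner (coord_tangent W p) (W N * layer \<sigma> X W N - Y)
      = frob_inner (W N * layer \<sigma> X W N - Y) (coord_tangent W p)"
    using preact_tangent_carrier[OF assms weights_coord_direction, of N p] Y
    by (auto simp: frob_inner_def mult.commute)
  show ?thesis
    unfolding loss_eq[OF weights_set_entry[OF assms]]
    by (rule DERIV_cong[OF DERIV_cmult[OF has_real_derivative_frob_inner[OF
              misfit_has_mat_derivative[OF assms] misfit_has_mat_derivative[OF assms]]]])
      (simp add: set_entry_self comm)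
qed

lemma partially_differentiable_loss:
  "weights W \<Longrightarrow> partially_differentiable (loss \<sigma> N X Y) p W"
  unfolding partially_differentiable_def
  using loss_has_real_derivative real_differentiable_def by blast

lemma partial_deriv_loss:
  "weights W \<Longrightarrow> partial_deriv (loss \<sigma> N X Y) p W
    = frob_inner (W N * layer \<sigma> X W N - Y) (coord_tangent W p)"
  unfolding partial_deriv_def by (intro DERIV_imp_deriv loss_has_real_derivative)

text \<open>H_i depends only on the blocks before \<open>i\<close>, so moving block \<open>j\<close>
  leaves it fixed even for i = j.\<close>

lemma layer_tangent_coord_direction_eq_0:
  assumes "weights W" "i \<le> j" "i \<le> N"
  shows "layer_tangent \<sigma> X W (coord_direction (j, a, b)) i = 0\<^sub>m (s i) d"
  using assms(2,3)
proof (induction i)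
  case 0
  show ?case using X by simp
next
  case (Suc i)
  have "W i \<in> carrier_mat (s (Suc i)) (s i)" "layer \<sigma> X W i \<in> carrier_mat (s i) d"
    using assms(1) Suc.prems by (auto intro: weightsD layer_carrier)
  then show ?case using Suc by (auto simp: coord_direction_def hadamard_def)
qed

text \<open>Moving first W_{j+1} and then the diagonal factor of activation derivatives to the other
  side of the inner product builds exactly the backward recursion for A_j.\<close>

lemma frob_inner_backprop_step:
  assumes "weights W" "weights V" "j < N"
  shows "frob_inner (backprop \<sigma> N X Y W (Suc j)) (W (Suc j) * layer_tangent \<sigma> X W V (Suc j))
    = frob_inner (backprop \<sigma> N X Y W j) (preact_tangent \<sigma> X W V j)"
proof -
  let ?B = "backprop \<sigma> N X Y W (Suc j)"
  let ?D = "map_mat (deriv (\<sigma> (Suc j))) (W j * layer \<sigma> X W j)"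
  have c: "?B \<in> carrier_mat (s (Suc (Suc j))) d"
    "W (Suc j) \<in> carrier_mat (s (Suc (Suc j))) (s (Suc j))"
    "layer_tangent \<sigma> X W V (Suc j) \<in> carrier_mat (s (Suc j)) d"
    "preact_tangent \<sigma> X W V j \<in> carrier_mat (s (Suc j)) d"
    "?D \<in> carrier_mat (s (Suc j)) d"
    using assms weightsD[of W j] layer_carrier[of W j]
    by (auto intro!: backprop_carrier weightsD layer_tangent_carrier preact_tangent_carrier
        simp del: layer_tangent.simps)
  have "frob_inner ?B (W (Suc j) * layer_tangent \<sigma> X W V (Suc j))
      = frob_inner (transpose_mat (W (Suc j)) * ?B) (?D \<circ>\<^sub>H preact_tangent \<sigma> X W V j)"
    by (subst frob_inner_adjoint[OF c(1-3)]) (simp add: preact_tangent_def)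
  also have "\<dots> = frob_inner (?D \<circ>\<^sub>H (transpose_mat (W (Suc j)) * ?B)) (preact_tangent \<sigma> X W V j)"
    using c by (intro frob_inner_hadamard) auto
  finally show ?thesis
    using assms(3) by (subst (2) backprop.simps) simp
qed

text \<open>The pairing of A_k with S_k is the same for all k from \<open>j\<close> to
  \<open>N\<close>. At \<open>N\<close> it is the derivative of the loss; at \<open>j\<close> it can
  be read off, as S_j is a matrix unit times H_j.\<close>

lemma frob_inner_coord_tangent:
  assumes "weights W" "(j, a, b) \<in> set (coords N W)"
  shows "frob_inner (W N * layer \<sigma> X W N - Y) (coord_tangent W (j, a, b))
    = (backprop \<sigma> N X Y W j * transpose_mat (layer \<sigma> X W j)) $$ (a, b)"
proof -
  let ?V = "coord_direction (j, a, b)"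
  let ?B = "backprop \<sigma> N X Y W"
  let ?S = "preact_tangent \<sigma> X W ?V"
  have j: "j \<le> N" and ab: "a < s (Suc j)" "b < s j"
    using assms(2) weightsD[OF assms(1), of j] by (auto simp: set_coords)
  have "frob_inner (?B k) (?S k) = frob_inner (?B j) (?S j)" if "j \<le> k" "k \<le> N" for k
    using that
  proof (induction rule: dec_induct)
    case (step k)
    \<comment> \<open>The direction vanishes in blocks above \<open>j\<close>, so only the
      propagated term remains.\<close>
    have "?S (Suc k) = W (Suc k) * layer_tangent \<sigma> X W ?V (Suc k)"
      using step assms(1) layer_carrier[OF assms(1), of "Suc k"] weightsD[OF assms(1), of "Suc k"]
        layer_tangent_carrier[OF assms(1) weights_coord_direction, of "Suc k" "(j, a, b)"]
      by (auto simp: preact_tangent_def coord_direction_def simp del: layer_tangent.simps layer.simps)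
    then show ?case
      using step frob_inner_backprop_step[OF assms(1) weights_coord_direction, of k "(j, a, b)"]
      by simp
  qed simp
  from this[OF j order_refl] have "frob_inner (?B N) (?S N) = frob_inner (?B j) (?S j)" .
  moreover have "?B N = W N * layer \<sigma> X W N - Y"
    by (subst backprop.simps) simp
  \<comment> \<open>Conversely, at block \<open>j\<close> the incoming layer is still fixed, so only
    the direct term remains.\<close>
  moreover have "?S j = unit_mat (s (Suc j)) (s j) a b * layer \<sigma> X W j"
    using layer_tangent_coord_direction_eq_0[OF assms(1) order_refl j]
      weightsD[OF assms(1) j] layer_carrier[OF assms(1) j]
    by (auto simp: preact_tangent_def coord_direction_def unit_mat_def)
  ultimately show ?thesis
    using frob_inner_unit_mat_mult[OF backprop_carrier[OF assms(1) j] layer_carrier[OF assms(1) j] ab]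
    by simp
qed

lemma grad_block_loss:
  assumes "weights W" "j \<le> N"
  shows "grad_block (loss \<sigma> N X Y) j W
    = backprop \<sigma> N X Y W j * transpose_mat (layer \<sigma> X W j)"
  using weightsD[OF assms] backprop_carrier[OF assms] layer_carrier[OF assms] assms
  by (intro eq_matI)
    (auto simp: grad_block_def partial_deriv_loss frob_inner_coord_tangent set_coords)

text \<open>The formula for the first partial derivative holds all along the coordinate line, so the
  product rule applies to it again. \<open>T\<close> collects the second derivatives of the network
  output.\<close>

lemma partial_deriv_loss_has_real_derivative:
  assumes "weights W"
  obtains T where "T \<in> carrier_mat (s (Suc N)) d"
    and "((\<lambda>t. partial_deriv (loss \<sigma> N X Y) p (set_entry W q t)) has_real_derivative
      frob_inner (coord_tangent W q) (coord_tangent W p)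
        + frob_inner (W N * layer \<sigma> X W N - Y) T) (at (entry W q))"
proof -
  obtain T where T: "has_mat_derivative (s (Suc N)) d
      (\<lambda>u. coord_tangent (set_entry W q u) p) T (entry W q)"
    using preact_tangent_has_mat_derivative[of "set_entry W q" "coord_direction q" "entry W q"
        "coord_direction p" N] set_entry_has_mat_derivative[OF assms] weights_coord_direction
    by blast
  show thesis
  proof (rule that[of T])
    show "T \<in> carrier_mat (s (Suc N)) d"
      using has_mat_derivativeD(2)[OF T] .
    show "((\<lambda>t. partial_deriv (loss \<sigma> N X Y) p (set_entry W q t)) has_real_derivative
      frob_inner (coord_tangent W q) (coord_tangent W p)
        + frob_inner (W N * layer \<sigma> X W N - Y) T) (at (entry W q))"
      unfolding partial_deriv_loss[OF weights_set_entry[OF assms]]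
      using has_real_derivative_frob_inner[OF misfit_has_mat_derivative[OF assms, of q] T]
      by (simp add: set_entry_self)
  qed
qed

lemma twice_partially_differentiable_loss:
  assumes "weights W"
  shows "twice_partially_differentiable (loss \<sigma> N X Y) N W"
proof -
  have "partially_differentiable (partial_deriv (loss \<sigma> N X Y) p) q W" for p q
    unfolding partially_differentiable_def
    using partial_deriv_loss_has_real_derivative[OF assms, of p q] real_differentiable_def by metis
  then show ?thesis
    \<comment> \<open>First partial derivatives exist on the whole line, hence in particular near
      \<open>W\<close>.\<close>
    unfolding twice_partially_differentiable_def
    using partially_differentiable_loss[OF weights_set_entry[OF assms]] by simp
qed

text \<open>The second derivatives of the network are paired with a zero misfit; only the
  Gauss-Newton term survives.\<close>

lemma second_partial_deriv_loss:
  assumes "weights W" "W N * layer \<sigma> X W N = Y"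
  shows "partial_deriv (partial_deriv (loss \<sigma> N X Y) p) q W
    = frob_inner (coord_tangent W q) (coord_tangent W p)"
proof -
  obtain T where T: "T \<in> carrier_mat (s (Suc N)) d"
    "((\<lambda>t. partial_deriv (loss \<sigma> N X Y) p (set_entry W q t)) has_real_derivative
      frob_inner (coord_tangent W q) (coord_tangent W p)
        + frob_inner (W N * layer \<sigma> X W N - Y) T) (at (entry W q))"
    by (rule partial_deriv_loss_has_real_derivative[OF assms(1)])
  moreover have "frob_inner (W N * layer \<sigma> X W N - Y) T = 0"
    using assms(2) Y by (auto simp: frob_inner_def)
  ultimately show ?thesis
    unfolding partial_deriv_def[of _ q] by (intro DERIV_imp_deriv) simp
qed

lemma second_order_local_min_loss:
  assumes "weights W" "W N * layer \<sigma> X W N = Y"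
  shows "second_order_local_min (loss \<sigma> N X Y) N W"
proof -
  let ?K = "length (coords N W)"
  \<comment> \<open>\<open>f k\<close> is the Jacobian column of the \<open>k\<close>-th coordinate,
    read as a vector over matrix positions.\<close>
  define f where "f k = (\<lambda>ik. coord_tangent W (coords N W ! k) $$ ik)" for k
  have "frob_inner (coord_tangent W q) (coord_tangent W p)
      = (\<Sum>ik\<in>{..<s (Suc N)} \<times> {..<d}. coord_tangent W p $$ ik * coord_tangent W q $$ ik)" for p q
    using preact_tangent_carrier[OF assms(1) weights_coord_direction, of N q]
    by (auto simp: frob_inner_def sum.cartesian_product mult.commute intro!: sum.cong)
  then have H: "hessian (loss \<sigma> N X Y) N W
      = mat ?K ?K (\<lambda>(k, l). \<Sum>ik\<in>{..<s (Suc N)} \<times> {..<d}. f l ik * f k ik)"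
    by (simp add: hessian_def second_partial_deriv_loss[OF assms] f_def)
  show ?thesis
    unfolding second_order_local_min_def H
    using twice_partially_differentiable_loss[OF assms(1)]
    by (intro conjI allI impI) (assumption | drule gram_eigenvalue_nonneg, blast)+
qed

section \<open>Stationary points\<close>

lemma stationary_point_loss_iff:
  assumes "weights W"
  shows "stationary_point (loss \<sigma> N X Y) N W \<longleftrightarrow>
    (\<forall>j\<le>N. backprop \<sigma> N X Y W j \<bottom>\<^sub>M transpose_mat (layer \<sigma> X W j))"
proof -
  have "grad_block (loss \<sigma> N X Y) j W = 0\<^sub>m (dim_row (W j)) (dim_col (W j))
      \<longleftrightarrow> backprop \<sigma> N X Y W j \<bottom>\<^sub>M transpose_mat (layer \<sigma> X W j)" if "j \<le> N" for j
    using weightsD[OF assms that] grad_block_loss[OF assms that]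
      mat_perp_iff[OF backprop_carrier[OF assms that], of "transpose_mat (layer \<sigma> X W j)" "s j"]
      layer_carrier[OF assms that] by auto
  then show ?thesis
    unfolding stationary_point_def using partially_differentiable_loss[OF assms] by auto
qed

text \<open>Zero misfit annihilates every A_j through the backward recursion, so case (1) of the
  theorem is contained in case (2).\<close>

lemma stationary_point_if_zero_misfit:
  assumes "weights W" "W N * layer \<sigma> X W N = Y"
  shows "stationary_point (loss \<sigma> N X Y) N W"
  unfolding stationary_point_loss_iff[OF assms(1)]
proof (intro allI impI)
  fix j assume j: "j \<le> N"
  show "backprop \<sigma> N X Y W j \<bottom>\<^sub>M transpose_mat (layer \<sigma> X W j)"
    unfolding backprop_eq_0[OF assms j] using layer_carrier[OF assms(1) j]
    by (auto simp: mat_perp_def)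
qed

end

section \<open>The theorem, from its own shapes and indices\<close>

theorem theorem4:
  fixes N n d m :: nat
    and r :: "nat \<Rightarrow> nat"
    and X Y :: "real mat"
    and \<sigma> :: "nat \<Rightarrow> real \<Rightarrow> real"
    and W :: "nat \<Rightarrow> real mat"
  assumes "1 \<le> N"
    and "X \<in> carrier_mat n d"
    and "Y \<in> carrier_mat m d"
    and "\<forall>j\<in>{1..N}. \<forall>x. \<sigma> j differentiable (at x)"
    and "\<forall>j\<in>{1..N}. \<forall>x. deriv (\<sigma> j) differentiable (at x)"
    and "W 0 \<in> carrier_mat (r 0) n"
    and "\<forall>j\<in>{1..N - 1}. W j \<in> carrier_mat (r j) (r (j - 1))"
    and "W N \<in> carrier_mat m (r (N - 1))"
  defines "F \<equiv> loss \<sigma> N X Y"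
    and "H \<equiv> layer \<sigma> X W"
    and "A \<equiv> backprop \<sigma> N X Y W"
  shows "(\<forall>p\<in>set (coords N W). partially_differentiable F p W) \<and>
    (\<forall>j\<le>N. grad_block F j W = A j * transpose_mat (H j)) \<and>
    (stationary_point F N W \<longleftrightarrow>
       W N * H N = Y \<or> (\<forall>j\<le>N. A j \<bottom>\<^sub>M transpose_mat (H j))) \<and>
    (W N * H N = Y \<longrightarrow> second_order_local_min F N W)"
proof -
  \<comment> \<open>The widths are shifted by one: \<open>s 0\<close> is the input size,
    \<open>s (Suc i)\<close> the row number of block \<open>i\<close>, with \<open>m\<close> for the
    last block.\<close>
  define s where "s j = (case j of 0 \<Rightarrow> n | Suc i \<Rightarrow> if i = N then m else r i)" for j
  interpret network N d s X Y \<sigma>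
    using assms(1-5) by unfold_locales (auto simp: s_def)
  have W: "weights W"
    unfolding weights_def
  proof (intro allI impI)
    fix j assume "j \<le> N"
    \<comment> \<open>As \<open>1 \<le> N\<close>, the first and last blocks are distinct and the
      three shape assumptions cover all blocks.\<close>
    then consider "j = 0" | "j \<in> {1..N - 1}" | "j = N" by force
    then show "W j \<in> carrier_mat (s (Suc j)) (s j)"
    proof cases
      case 2
      then have "W j \<in> carrier_mat (r j) (r (j - 1))" using assms(7) by blast
      with 2 show ?thesis by (auto simp: s_def split: nat.splits)
    qed (use assms(1,6,8) in \<open>auto simp: s_def split: nat.splits\<close>)
  qed
  show ?thesis
    unfolding F_def H_def A_def
    \<comment> \<open>Since zero misfit implies stationarity, adding case (1) as a disjunct keeps
      the equivalence.\<close>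
    using partially_differentiable_loss[OF W] grad_block_loss[OF W] stationary_point_loss_iff[OF W]
      stationary_point_if_zero_misfit[OF W] second_order_local_min_loss[OF W]
    by blast
qed

end
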